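(* Consider the $[pqrs]$ random walk on $\{0,1,\dots,N\}$ ($N\ge 2$) described in the context, with $r_0<1$ and $r_N<1$, started in $i_0\in\{0,1,\dots,N\}$, and let $x_n=\sum_{k=0}^\infty p_{i_0,n}^{(k)}$ be the expected number of arrivals (visits) in state $n$. Put $$D=\xi_2^{N-2}v_2w_1-\xi_1^{N-2}v_1w_2 .$$ Then $$x_0=\frac{\xi_1^{N-1-i_0}w_2-\xi_2^{N-1-i_0}w_1}{D},$$ $$x_n=\frac{\zeta_1\left(\xi_2^{N-1-i_0}w_1-\xi_1^{N-1-i_0}w_2\right)\left(\xi_1^{n-1}v_1-\xi_2^{n-1}v_2\right)}{D}\qquad(1\le n\le \min(i_0,N-1)),$$ $$x_n=\frac{\zeta_1\left(\xi_1^{n-1}\xi_2^{N-2}w_1-\xi_1^{N-2}\xi_2^{n-1}w_2\right)\left(\xi_2^{1-i_0}v_1-\xi_1^{1-i_0}v_2\right)}{D}\qquad(\max(i_0,1)\le n\le N-1),$$ $$x_N=\frac{(p/q)^{N-2}\left(\xi_2^{1-i_0}v_1-\xi_1^{1-i_0}v_2\right)}{D}.$$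
   Context: The walk: let $p,q,s>0$, $r\ge0$, $p+q+r+s=1$. In each state $n\in\{1,\dots,N-1\}$, at each time step the particle moves to $n+1$ with probability $p$, moves to $n-1$ with probability $q$, stays in $n$ with probability $r$, or is absorbed in $n$ (removed) with probability $s$. In state $0$ it moves to $1$ with probability $p_0$, stays with probability $r_0$, is absorbed with probability $s_0$, where $p_0,r_0,s_0\ge0$, $p_0+r_0+s_0=1$. In state $N$ it moves to $N-1$ with probability $q_N$, stays with probability $r_N$, is absorbed with probability $s_N$, where $q_N,r_N,s_N\ge0$, $q_N+r_N+s_N=1$. Here $p_{i,j}^{(k)}$ is the probability that the particle, starting in $i$ at time $0$, has not been absorbed and is in state $j$ after $k$ steps (so $p_{i,j}^{(0)}=\delta(i,j)$). Notation: $$\xi_1=\frac{(1-r)+\sqrt{(1-r)^2-4pq}}{2q},\quad \xi_2=\frac{(1-r)-\sqrt{(1-r)^2-4pq}}{2q},\quad \zeta_1=\left[(1-r)^2-4pq\right]^{-1/2},$$ $$v_i=p_0-(1-r_0)\xi_i,\qquad w_i=q_N-(1-r_N)\xi_i^{-1}\qquad(i=1,2).$$ *)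

theory Defs
  imports "HOL-Probability.Probability"
begin

text \<open>
  A particle is in \<open>Some n\<close> while it is alive in state \<open>n\<close>, and in \<open>None\<close> once it has been
  absorbed (removed), whichever state it was absorbed in.  The weights below form a probability
  distribution only under the standing assumptions on the parameters (\<open>pmf_of_list_wf\<close>).
  States \<open>n > N\<close> are never reached from \<open>{0..N}\<close>; the value there is irrelevant.
\<close>

definition pqrs_step ::
  "nat \<Rightarrow> real \<Rightarrow> real \<Rightarrow> real \<Rightarrow> real \<Rightarrow> real \<Rightarrow> real \<Rightarrow> real \<Rightarrow> real \<Rightarrow> real \<Rightarrow> real
    \<Rightarrow> nat option \<Rightarrow> nat option pmf" where
  "pqrs_step N p q r s p0 r0 s0 qN rN sN st =
    (case st of
       None \<Rightarrow> return_pmf None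
     | Some n \<Rightarrow>
         if n = 0 then pmf_of_list [(Some 1, p0), (Some 0, r0), (None, s0)]
         else if n = N then pmf_of_list [(Some (N - 1), qN), (Some N, rN), (None, sN)]
         else pmf_of_list [(Some (n + 1), p), (Some (n - 1), q), (Some n, r), (None, s)])"

primrec chain_dist :: "('a \<Rightarrow> 'a pmf) \<Rightarrow> 'a \<Rightarrow> nat \<Rightarrow> 'a pmf" where
  "chain_dist K i 0 = return_pmf i"
| "chain_dist K i (Suc k) = bind_pmf (chain_dist K i k) K"

definition kstep_prob :: "(nat option \<Rightarrow> nat option pmf) \<Rightarrow> nat \<Rightarrow> nat \<Rightarrow> nat \<Rightarrow> real" where
  "kstep_prob K k i j = pmf (chain_dist K (Some i) k) (Some j)"

end

theory Submission
  imports Defs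
begin

text \<open>
  Fix the target state \<open>n\<close> and let the starting state \<open>i\<close> vary.  The expected number \<open>h i\<close> of visits
  to \<open>n\<close> obeys the first-step equations \<open>h i = \<delta>(i,n) + \<Sum>\<^sub>j P(i,j) h j\<close>.  Reading the chain in this
  direction has two advantages over the balance equations in \<open>n\<close>.

  First, the coefficients of equation \<open>i\<close> depend only on the state \<open>i\<close> that the particle leaves, so
  all interior equations except the one at \<open>n\<close> are the same recurrence \<open>(1 - r) h i = p h (i + 1) + q h (i - 1)\<close>, up to
  and including the ones next to the boundary.  Its solutions are spanned by \<open>\<xi>1 powi (- i)\<close> and
  \<open>\<xi>2 powi (- i)\<close>, and the coefficients \<open>v\<close> and \<open>w\<close> are what it takes to satisfy the equation at
  \<open>0\<close> (the function \<open>left_sol\<close>) or the equation at \<open>N\<close> (the function \<open>right_sol\<close>).  The solution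
  with a source at \<open>n\<close> is then a Green function: \<open>left_sol\<close> to the left of \<open>n\<close>, \<open>right_sol\<close> to the
  right of \<open>n\<close>, matched at \<open>n\<close>.  Only equation \<open>n\<close> remains, and it fixes the normalisation.
  For an interior \<open>n\<close> it involves the Casoratian (the discrete Wronskian) of the two solutions, for
  \<open>n = 0\<close> or \<open>n = N\<close> the defect of one of them in a boundary equation; each is \<open>D\<close> up to an
  explicit factor (\<open>casoratian\<close>, \<open>right_sol_row_0\<close>, \<open>left_sol_row_N\<close>).  That \<open>D\<close> does not vanish follows from comparing the factors of its two
  products, since \<open>\<xi>2 < 1 < \<xi>1\<close> (\<open>det_D_neg\<close>).

  Second, neither convergence of the visit series nor uniqueness for the linear system needs
  a separate argument.  Iterating the first-step equations \<open>m\<close> times gives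
  \<open>h i = (\<Sum>k<m. P\<^sup>k(i,n)) + \<Sum>\<^sub>j P\<^sup>m(i,j) h j\<close>, so any solution \<open>h\<close> is the sum of the visit series
  as soon as the last term tends to \<open>0\<close> (\<open>expected_visits_sums\<close>).  It does so geometrically because
  some positive function on the living states shrinks by a factor \<open>\<rho> < 1\<close> in expectation in every
  step.  Absorption at the two end states may be impossible, so the constant function does not
  serve; the value \<open>1 + s\<close> at the ends and \<open>1\<close> in the interior does, as a particle at an end is absorbed
  or steps inside sooner or later, and inside it risks absorption (\<open>visits_sums\<close>).
\<close>

section \<open>Potential functions of a killed chain\<close>

lemma set_pmf_chain_dist:
  assumes "\<And>x. x \<in> S \<Longrightarrow> set_pmf (K x) \<subseteq> S" "i \<in> S"
  shows "set_pmf (chain_dist K i k) \<subseteq> S"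
  using assms by (induction k) (auto simp: set_bind_pmf)

lemma expectation_chain_dist_Suc:
  fixes f :: "'a \<Rightarrow> real"
  assumes S: "finite S" "\<And>x. x \<in> S \<Longrightarrow> set_pmf (K x) \<subseteq> S" "i \<in> S"
  shows "measure_pmf.expectation (chain_dist K i (Suc k)) f =
         (\<Sum>x\<in>S. pmf (chain_dist K i k) x * measure_pmf.expectation (K x) f)"
  using pmf_expectation_bind[of S K "chain_dist K i k" f] S set_pmf_chain_dist[OF S(2,3), where k = k]
  by (auto intro: finite_subset)

lemma expectation_on_finite:
  fixes f :: "'a \<Rightarrow> real"
  assumes "finite S" "set_pmf M \<subseteq> S"
  shows "measure_pmf.expectation M f = (\<Sum>x\<in>S. pmf M x * f x)"
  using assms by (subst integral_measure_pmf[of S]) auto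

text \<open>
  The function \<open>u\<close> is a Lyapunov function: it forces the expectation of \<open>h\<close> at time \<open>m\<close>, which is
  the remainder after \<open>m\<close> terms of the series, to be at most \<open>C * \<rho> ^ m * u i\<close>.  A
  cemetery state fits in with \<open>u = h = 0\<close>.
\<close>

lemma expected_visits_sums:
  fixes h u :: "'a \<Rightarrow> real"
  assumes S: "finite S" "\<And>x. x \<in> S \<Longrightarrow> set_pmf (K x) \<subseteq> S" "i \<in> S"
    and h: "\<And>x. x \<in> S \<Longrightarrow> h x = of_bool (x = y) + measure_pmf.expectation (K x) h"
    and bound: "\<And>x. x \<in> S \<Longrightarrow> \<bar>h x\<bar> \<le> C * u x"
    and u: "\<And>x. x \<in> S \<Longrightarrow> measure_pmf.expectation (K x) u \<le> \<rho> * u x"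
    and "0 \<le> \<rho>" "\<rho> < 1" "0 \<le> C" "y \<in> S"
  shows "(\<lambda>k. pmf (chain_dist K i k) y) sums h i"
proof -
  define E where "E k f = measure_pmf.expectation (chain_dist K i k) f" for k and f :: "'a \<Rightarrow> real"
  have E: "E k f = (\<Sum>x\<in>S. pmf (chain_dist K i k) x * f x)" for k f
    unfolding E_def by (rule expectation_on_finite[OF S(1) set_pmf_chain_dist[OF S(2,3)]])
  have E_Suc: "E (Suc k) f = (\<Sum>x\<in>S. pmf (chain_dist K i k) x * measure_pmf.expectation (K x) f)"
    for k f
    unfolding E_def by (rule expectation_chain_dist_Suc[OF S])
  have iterate: "h i = (\<Sum>k<m. pmf (chain_dist K i k) y) + E m h" for m
  proof (induction m)
    case 0
    then show ?case by (simp add: E_def)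
  next
    case (Suc m)
    have "E m h = (\<Sum>x\<in>S. pmf (chain_dist K i m) x *
                     (of_bool (x = y) + measure_pmf.expectation (K x) h))"
      unfolding E using h by (intro sum.cong) auto
    also have "\<dots> = (\<Sum>x\<in>S. if x = y then pmf (chain_dist K i m) x else 0) + E (Suc m) h"
      unfolding E_Suc sum.distrib[symmetric] by (intro sum.cong) (auto simp: algebra_simps)
    also have "\<dots> = pmf (chain_dist K i m) y + E (Suc m) h"
      using S(1) \<open>y \<in> S\<close> by simp
    finally show ?case using Suc by simp
  qed
  have decay: "E m u \<le> \<rho> ^ m * u i" for m
  proof (induction m)
    case 0
    then show ?case by (simp add: E_def)
  next
    case (Suc m)
    have "E (Suc m) u \<le> (\<Sum>x\<in>S. pmf (chain_dist K i m) x * (\<rho> * u x))"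
      unfolding E_Suc using u by (intro sum_mono mult_left_mono) auto
    also have "\<dots> = \<rho> * E m u"
      unfolding E by (simp add: sum_distrib_left mult_ac)
    also have "\<dots> \<le> \<rho> * (\<rho> ^ m * u i)"
      using Suc \<open>0 \<le> \<rho>\<close> by (intro mult_left_mono)
    finally show ?case by (simp add: mult_ac)
  qed
  have remainder: "\<bar>E m h\<bar> \<le> C * u i * \<rho> ^ m" for m
  proof -
    have "\<bar>E m h\<bar> \<le> (\<Sum>x\<in>S. \<bar>pmf (chain_dist K i m) x * h x\<bar>)"
      unfolding E by (rule sum_abs)
    also have "\<dots> \<le> (\<Sum>x\<in>S. pmf (chain_dist K i m) x * (C * u x))"
      using bound by (intro sum_mono) (auto simp: abs_mult intro: mult_left_mono)
    also have "\<dots> = C * E m u"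
      unfolding E by (simp add: sum_distrib_left mult_ac)
    also have "\<dots> \<le> C * (\<rho> ^ m * u i)"
      using decay \<open>0 \<le> C\<close> by (intro mult_left_mono)
    finally show ?thesis by (simp add: mult_ac)
  qed
  have "(\<lambda>m. C * u i * \<rho> ^ m) \<longlonglongrightarrow> C * u i * 0"
    using \<open>0 \<le> \<rho>\<close> \<open>\<rho> < 1\<close> by (intro tendsto_mult tendsto_const LIMSEQ_realpow_zero)
  then have "(\<lambda>m. C * u i * \<rho> ^ m) \<longlonglongrightarrow> 0"
    by simp
  then have "(\<lambda>m. E m h) \<longlonglongrightarrow> 0"
    by (rule Lim_null_comparison[rotated]) (simp add: remainder)
  then have "(\<lambda>m. h i - E m h) \<longlonglongrightarrow> h i - 0"
    by (intro tendsto_diff tendsto_const)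
  moreover have "(\<lambda>m. h i - E m h) = (\<lambda>m. \<Sum>k<m. pmf (chain_dist K i k) y)"
  proof
    show "h i - E m h = (\<Sum>k<m. pmf (chain_dist K i k) y)" for m
      using iterate[of m] by linarith
  qed
  ultimately show ?thesis
    by (simp add: sums_def)
qed

section \<open>First-step equations of the walk\<close>

lemma expectation_pmf_of_list:
  fixes f :: "'a \<Rightarrow> real"
  assumes "pmf_of_list_wf xs"
  shows "measure_pmf.expectation (pmf_of_list xs) f = (\<Sum>(x, w)\<leftarrow>xs. w * f x)"
proof -
  have regroup: "(\<Sum>a\<in>A. sum_list (map snd (filter (\<lambda>z. fst z = a) ys)) * f a) =
                 (\<Sum>(x, w)\<leftarrow>ys. w * f x)"
    if "finite A" "set (map fst ys) \<subseteq> A" for A and ys :: "('a \<times> real) list"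
    using that(2)
  proof (induction ys)
    case Nil
    then show ?case by simp
  next
    case (Cons z ys)
    have "(\<Sum>a\<in>A. sum_list (map snd (filter (\<lambda>y. fst y = a) (z # ys))) * f a) =
          (\<Sum>a\<in>A. (if fst z = a then snd z * f a else 0)
                  + sum_list (map snd (filter (\<lambda>y. fst y = a) ys)) * f a)"
      by (intro sum.cong) (auto simp: algebra_simps)
    also have "\<dots> = snd z * f (fst z) + (\<Sum>(x, w)\<leftarrow>ys. w * f x)"
      using Cons that(1) by (simp add: sum.distrib)
    also have "\<dots> = (\<Sum>(x, w)\<leftarrow>z # ys. w * f x)"
      by (cases z) simp
    finally show ?case .
  qed
  have "measure_pmf.expectation (pmf_of_list xs) f =
        (\<Sum>a\<in>set (map fst xs). pmf (pmf_of_list xs) a * f a)"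
    using set_pmf_of_list[OF assms] by (intro expectation_on_finite) auto
  then show ?thesis
    using regroup[of "set (map fst xs)" xs] by (simp add: pmf_pmf_of_list[OF assms])
qed

locale pqrs_walk =
  fixes p q r s p0 r0 s0 qN rN sN :: real and N :: nat
  assumes interior_weights: "p > 0" "q > 0" "s > 0" "r \<ge> 0" "p + q + r + s = 1"
    and left_weights: "p0 \<ge> 0" "r0 \<ge> 0" "s0 \<ge> 0" "p0 + r0 + s0 = 1"
    and right_weights: "qN \<ge> 0" "rN \<ge> 0" "sN \<ge> 0" "qN + rN + sN = 1"
    and ends_not_trapping: "r0 < 1" "rN < 1"
    and N_ge_2: "N \<ge> 2"
begin

abbreviation step :: "nat option \<Rightarrow> nat option pmf" where
  "step \<equiv> pqrs_step N p q r s p0 r0 s0 qN rN sN"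

definition states :: "nat option set" where
  "states = insert None (Some ` {..N})"

lemma weights_wf:
  "pmf_of_list_wf [(Some 1, p0), (Some 0, r0), (None, s0)]"
  "pmf_of_list_wf [(Some (N - 1), qN), (Some N, rN), (None, sN)]"
  "pmf_of_list_wf [(Some (n + 1), p), (Some (n - 1), q), (Some n, r), (None, s)]"
  using interior_weights left_weights right_weights
  by (auto simp: pmf_of_list_wf_def algebra_simps)

lemma step_closed:
  assumes "st \<in> states"
  shows "set_pmf (step st) \<subseteq> states"
proof (cases st)
  case None
  then show ?thesis by (simp add: pqrs_step_def states_def)
next
  case (Some n)
  then have "n \<le> N" using assms by (auto simp: states_def)
  then consider "n = 0" | "n = N" | "0 < n" "n < N" by linarith
  then show ?thesis
  proof cases
    case 1
    then have "{Some 1, Some 0, None} \<subseteq> states"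
      using N_ge_2 by (auto simp: states_def)
    then show ?thesis
      using 1 Some set_pmf_of_list[OF weights_wf(1)]
      by (auto simp: pqrs_step_def simp del: One_nat_def)
  next
    case 2
    then have "{Some (N - 1), Some N, None} \<subseteq> states"
      by (auto simp: states_def)
    then show ?thesis
      using 2 Some N_ge_2 set_pmf_of_list[OF weights_wf(2)] by (auto simp: pqrs_step_def)
  next
    case 3
    then have "{Some (n + 1), Some (n - 1), Some n, None} \<subseteq> states"
      by (auto simp: states_def)
    then show ?thesis
      using 3 Some set_pmf_of_list[OF weights_wf(3)[of n]] by (auto simp: pqrs_step_def)
  qed
qed

lemma expectation_step:
  fixes f :: "nat option \<Rightarrow> real"
  assumes "f None = 0"
  shows "measure_pmf.expectation (step None) f = 0"
    and "measure_pmf.expectation (step (Some 0)) f = p0 * f (Some 1) + r0 * f (Some 0)"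
    and "measure_pmf.expectation (step (Some N)) f = qN * f (Some (N - 1)) + rN * f (Some N)"
    and "0 < n \<Longrightarrow> n < N \<Longrightarrow> measure_pmf.expectation (step (Some n)) f =
           p * f (Some (n + 1)) + q * f (Some (n - 1)) + r * f (Some n)"
  using assms N_ge_2 weights_wf(1,2)[THEN expectation_pmf_of_list[where f = f]]
    weights_wf(3)[of n, THEN expectation_pmf_of_list[where f = f]]
  by (simp_all add: pqrs_step_def)

text \<open>
  The function \<open>u\<close> in the proof contracts in expectation: an interior state loses mass \<open>s\<close>, which
  outweighs the factor \<open>1 + s\<close> gained at most by moving to an end, and an end state is left with
  positive probability, for a state with a smaller value or for the cemetery.
\<close>

lemma visits_sums:
  fixes h :: "nat \<Rightarrow> real"
  assumes row_0: "(1 - r0) * h 0 = of_bool (n = 0) + p0 * h 1"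
    and row_N: "(1 - rN) * h N = of_bool (n = N) + qN * h (N - 1)"
    and row: "\<And>i. 0 < i \<Longrightarrow> i < N \<Longrightarrow>
                (1 - r) * h i = of_bool (i = n) + p * h (i + 1) + q * h (i - 1)"
    and "n \<le> N" "i \<le> N"
  shows "(\<lambda>k. kstep_prob step k i n) sums h i"
proof -
  define H where "H = case_option 0 h"
  define u :: "nat option \<Rightarrow> real" where
    "u = case_option 0 (\<lambda>j. if j = 0 \<or> j = N then 1 + s else 1)"
  define C where "C = (\<Sum>j\<le>N. \<bar>h j\<bar>)"
  (* The three entries are the contraction factors at the interior states, at 0 and at N. *)
  define \<rho> where "\<rho> = Max {(1 - s) * (1 + s), (1 + s * r0) / (1 + s), (1 + s * rN) / (1 + s)}"
  have \<rho>: "(1 - s) * (1 + s) \<le> \<rho>" "(1 + s * r0) / (1 + s) \<le> \<rho>" "(1 + s * rN) / (1 + s) \<le> \<rho>"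
    unfolding \<rho>_def by (intro Max_ge; simp)+
  have "(1 - s) * (1 + s) < 1"
    using interior_weights by (simp add: algebra_simps)
  then have "\<rho> < 1"
    unfolding \<rho>_def using interior_weights ends_not_trapping by simp
  have "0 \<le> (1 - s) * (1 + s)"
    using interior_weights by (intro mult_nonneg_nonneg) auto
  with \<rho> have "0 \<le> \<rho>" by linarith
  have "0 \<le> C" by (simp add: C_def sum_nonneg)
  have "(\<lambda>k. pmf (chain_dist step (Some i) k) (Some n)) sums H (Some i)"
  proof (rule expected_visits_sums[where S = states and u = u and C = C and \<rho> = \<rho>])
    fix st assume st: "st \<in> states"
    show "H st = of_bool (st = Some n) + measure_pmf.expectation (step st) H"
    proof (cases st)
      case None
      then show ?thesis by (simp add: H_def expectation_step)
    next
      case (Some j)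
      then consider "j = 0" | "j = N" | "0 < j" "j < N"
        using st by (force simp: states_def)
      then show ?thesis
      proof cases
        case 1
        then show ?thesis
          using Some row_0 by (auto simp: expectation_step H_def algebra_simps)
      next
        case 2
        then show ?thesis
          using Some row_N by (auto simp: expectation_step H_def algebra_simps)
      next
        case 3
        then show ?thesis
          using Some row[of j] by (simp add: expectation_step H_def algebra_simps)
      qed
    qed
    show "\<bar>H st\<bar> \<le> C * u st"
    proof (cases st)
      case None
      then show ?thesis by (simp add: H_def u_def)
    next
      case (Some j)
      then have "j \<le> N" using st by (auto simp: states_def)
      then have "\<bar>h j\<bar> \<le> C"
        unfolding C_def by (intro member_le_sum[where f = "\<lambda>j. \<bar>h j\<bar>"]) auto
      also have "\<dots> \<le> C * u st"
        using \<open>0 \<le> C\<close> interior_weights Some by (simp add: u_def mult_le_cancel_left1)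
      finally show ?thesis using Some by (simp add: H_def)
    qed
    show "measure_pmf.expectation (step st) u \<le> \<rho> * u st"
    proof (cases st)
      case None
      then show ?thesis by (simp add: u_def expectation_step)
    next
      case (Some j)
      then consider "j = 0" | "j = N" | "0 < j" "j < N"
        using st by (force simp: states_def)
      then show ?thesis
      proof cases
        case 1
        have "measure_pmf.expectation (step st) u = p0 + r0 * (1 + s)"
          using 1 Some N_ge_2 by (simp add: expectation_step u_def)
        also have "\<dots> \<le> 1 + s * r0"
          using left_weights by (simp add: algebra_simps)
        also have "\<dots> \<le> \<rho> * (1 + s)"
          using \<rho>(2) interior_weights by (simp add: pos_divide_le_eq)
        finally show ?thesis using 1 Some by (simp add: u_def)
      next
        case 2
        have "measure_pmf.expectation (step st) u = qN + rN * (1 + s)"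
          using 2 Some N_ge_2 by (simp add: expectation_step u_def)
        also have "\<dots> \<le> 1 + s * rN"
          using right_weights by (simp add: algebra_simps)
        also have "\<dots> \<le> \<rho> * (1 + s)"
          using \<rho>(3) interior_weights by (simp add: pos_divide_le_eq)
        finally show ?thesis using 2 Some by (simp add: u_def)
      next
        case 3
        have le: "u (Some k) \<le> 1 + s" for k
          using interior_weights by (simp add: u_def)
        have "measure_pmf.expectation (step st) u =
              p * u (Some (j + 1)) + q * u (Some (j - 1)) + r * u (Some j)"
          using 3 Some by (simp add: expectation_step(4) u_def)
        also have "\<dots> \<le> p * (1 + s) + q * (1 + s) + r * (1 + s)"
          using interior_weights le by (intro add_mono mult_left_mono) auto
        also have "\<dots> = (p + q + r) * (1 + s)"
          by (simp add: algebra_simps)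
        also have "p + q + r = 1 - s"
          using interior_weights by simp
        finally show ?thesis using 3 Some \<rho>(1) by (simp add: u_def)
      qed
    qed
  qed (use \<open>0 \<le> \<rho>\<close> \<open>\<rho> < 1\<close> \<open>0 \<le> C\<close> \<open>n \<le> N\<close> \<open>i \<le> N\<close> step_closed in \<open>auto simp: states_def\<close>)
  then show ?thesis
    by (simp add: kstep_prob_def H_def)
qed

end

section \<open>Solving the first-step equations\<close>

text \<open>
  Vieta's formulas are all that is used about the roots of \<open>q \<xi>\<^sup>2 - (1 - r) \<xi> + p\<close>, besides their order.
\<close>

locale pqrs_roots = pqrs_walk +
  fixes \<xi>1 \<xi>2 :: real
  assumes roots_order: "0 < \<xi>2" "\<xi>2 < \<xi>1"
    and roots_sum: "q * (\<xi>1 + \<xi>2) = 1 - r"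
    and roots_prod: "q * (\<xi>1 * \<xi>2) = p"
begin

definition v :: "real \<Rightarrow> real" where
  "v \<xi> = p0 - (1 - r0) * \<xi>"

definition w :: "real \<Rightarrow> real" where
  "w \<xi> = qN - (1 - rN) * inverse \<xi>"

definition det_D :: real where
  "det_D = \<xi>2 ^ (N - 2) * v \<xi>2 * w \<xi>1 - \<xi>1 ^ (N - 2) * v \<xi>1 * w \<xi>2"

definition left_sol :: "nat \<Rightarrow> real" where
  "left_sol i = \<xi>2 powi (1 - int i) * v \<xi>1 - \<xi>1 powi (1 - int i) * v \<xi>2"

definition right_sol :: "nat \<Rightarrow> real" where
  "right_sol i = \<xi>2 powi (int N - 1 - int i) * w \<xi>1 - \<xi>1 powi (int N - 1 - int i) * w \<xi>2"

lemma roots_pos [simp]: "0 < \<xi>1" "0 < \<xi>2" "\<xi>1 \<noteq> 0" "\<xi>2 \<noteq> 0"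
  using roots_order by auto

lemma ratio_power: "(p / q) ^ k = \<xi>1 ^ k * \<xi>2 ^ k"
proof -
  have "p / q = \<xi>1 * \<xi>2"
    using roots_prod interior_weights(2) by (metis less_irrefl nonzero_mult_div_cancel_left)
  then show ?thesis by (simp add: power_mult_distrib)
qed

text \<open>The polynomial \<open>q \<xi>\<^sup>2 - (1 - r) \<xi> + p\<close> takes the value \<open>- s < 0\<close> at \<open>1\<close>.\<close>

lemma one_between_roots: "\<xi>2 < 1" "1 < \<xi>1"
proof -
  have "q * ((\<xi>1 - 1) * (1 - \<xi>2)) = s"
    using roots_sum roots_prod interior_weights by (simp add: algebra_simps)
  then have "0 < (\<xi>1 - 1) * (1 - \<xi>2)"
    using interior_weights by (metis zero_less_mult_pos)
  then show "\<xi>2 < 1" "1 < \<xi>1"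
    using roots_order by (auto simp: zero_less_mult_iff)
qed

text \<open>
  Since \<open>p0 \<le> 1 - r0\<close>, \<open>qN \<le> 1 - rN\<close> and \<open>\<xi>2 < 1 < \<xi>1\<close>, both \<open>v \<xi>1\<close> and \<open>w \<xi>2\<close> are negative.
  Their product \<open>v \<xi>1 * w \<xi>2\<close> is therefore positive, and it exceeds \<open>v \<xi>2 * w \<xi>1\<close>: this is clear if the latter
  is at most \<open>0\<close>.  Otherwise, if both its factors are negative they are smaller in absolute value
  than \<open>v \<xi>1\<close> and \<open>w \<xi>2\<close> by monotonicity; if both are positive, the bounds on \<open>p0\<close> and
  \<open>qN\<close> reduce the claim to \<open>\<xi>2 < \<xi>1\<close>.
\<close>

lemma det_D_neg: "det_D < 0"
proof -
  define a b where "a = 1 - r0" and "b = 1 - rN"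
  have ab: "0 < a" "0 < b" "p0 \<le> a" "qN \<le> b"
    using ends_not_trapping left_weights right_weights by (auto simp: a_def b_def)
  have inv: "1 < inverse \<xi>2" "inverse \<xi>1 < 1" "inverse \<xi>1 < inverse \<xi>2"
    using one_between_roots roots_order by (auto simp: one_less_inverse_iff inverse_less_1_iff)
  have v1: "v \<xi>1 \<le> - (a * (\<xi>1 - 1))"
    using ab by (simp add: v_def a_def[symmetric] algebra_simps)
  moreover have "0 < a * (\<xi>1 - 1)"
    using ab one_between_roots by simp
  ultimately have v1_neg: "v \<xi>1 < 0" by linarith
  have w2: "w \<xi>2 \<le> - (b * (inverse \<xi>2 - 1))"
    using ab by (simp add: w_def b_def[symmetric] algebra_simps)
  moreover have "0 < b * (inverse \<xi>2 - 1)"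
    using ab inv by simp
  ultimately have w2_neg: "w \<xi>2 < 0" by linarith
  have v_less: "v \<xi>1 < v \<xi>2"
    using ab roots_order by (simp add: v_def a_def)
  have w_less: "w \<xi>2 < w \<xi>1"
    using ab inv by (simp add: w_def b_def)
  have key: "v \<xi>2 * w \<xi>1 < v \<xi>1 * w \<xi>2"
  proof (cases "v \<xi>2 * w \<xi>1 \<le> 0")
    case True
    then show ?thesis
      using mult_neg_neg[OF v1_neg w2_neg] by linarith
  next
    case False
    then consider "v \<xi>2 > 0" "w \<xi>1 > 0" | "v \<xi>2 < 0" "w \<xi>1 < 0"
      by (auto simp: not_le zero_less_mult_iff)
    then show ?thesis
    proof cases
      case 1
      have "v \<xi>2 * w \<xi>1 \<le> (a * (1 - \<xi>2)) * (b * (1 - inverse \<xi>1))"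
        using 1 ab one_between_roots inv
        by (intro mult_mono) (auto simp: v_def w_def a_def[symmetric] b_def[symmetric] algebra_simps)
      also have "\<dots> = a * b * (1 - \<xi>2) * (\<xi>1 - 1) * inverse \<xi>1"
        by (simp add: field_simps)
      also have "\<dots> < a * b * (1 - \<xi>2) * (\<xi>1 - 1) * inverse \<xi>2"
        using ab one_between_roots inv by (intro mult_strict_left_mono) auto
      also have "\<dots> = (a * (\<xi>1 - 1)) * (b * (inverse \<xi>2 - 1))"
        by (simp add: field_simps)
      also have "\<dots> \<le> (- v \<xi>1) * (- w \<xi>2)"
        using v1 w2 v1_neg ab one_between_roots inv by (intro mult_mono) auto
      finally show ?thesis by simp
    next
      case 2
      have "(- v \<xi>2) * (- w \<xi>1) < (- v \<xi>1) * (- w \<xi>2)"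
        using 2 v_less w_less by (intro mult_strict_mono) auto
      then show ?thesis by simp
    qed
  qed
  have "\<xi>2 ^ (N - 2) * (v \<xi>2 * w \<xi>1) < \<xi>2 ^ (N - 2) * (v \<xi>1 * w \<xi>2)"
    using key by (intro mult_strict_left_mono) auto
  also have "\<dots> \<le> \<xi>1 ^ (N - 2) * (v \<xi>1 * w \<xi>2)"
    using roots_order mult_neg_neg[OF v1_neg w2_neg] by (intro mult_right_mono power_mono) (auto simp: less_imp_le)
  finally show ?thesis
    by (simp add: det_D_def mult_ac)
qed

lemma root_powi_recurrence:
  assumes "\<xi> \<in> {\<xi>1, \<xi>2}"
  shows "(1 - r) * \<xi> powi m = q * \<xi> powi (m + 1) + p * \<xi> powi (m - 1)"
proof -
  have [simp]: "\<xi> \<noteq> 0" using assms by auto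
  have "(1 - r) * \<xi> = q * \<xi> * \<xi> + p"
    using assms unfolding roots_sum[symmetric] roots_prod[symmetric]
    by (auto simp: algebra_simps)
  moreover have "\<xi> powi m = \<xi> powi (m - 1) * \<xi>" "\<xi> powi (m + 1) = \<xi> powi (m - 1) * \<xi> * \<xi>"
    using power_int_add_1[of \<xi> "m - 1"] power_int_add_1[of \<xi> m] by simp_all
  ultimately show ?thesis by algebra
qed

lemma left_sol_interior:
  assumes "0 < i"
  shows "(1 - r) * left_sol i = p * left_sol (i + 1) + q * left_sol (i - 1)"
proof -
  have "(1 - r) * \<xi> powi (1 - int i) =
        q * \<xi> powi (1 - int (i - 1)) + p * \<xi> powi (1 - int (i + 1))" if "\<xi> \<in> {\<xi>1, \<xi>2}" for \<xi>
    using root_powi_recurrence[OF that, of "1 - int i"] assms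
    by (simp add: of_nat_diff algebra_simps)
  from this[of \<xi>1] this[of \<xi>2] show ?thesis
    unfolding left_sol_def by simp algebra
qed

lemma right_sol_interior:
  assumes "0 < i"
  shows "(1 - r) * right_sol i = p * right_sol (i + 1) + q * right_sol (i - 1)"
proof -
  have "(1 - r) * \<xi> powi (int N - 1 - int i) =
        q * \<xi> powi (int N - 1 - int (i - 1)) + p * \<xi> powi (int N - 1 - int (i + 1))"
    if "\<xi> \<in> {\<xi>1, \<xi>2}" for \<xi>
    using root_powi_recurrence[OF that, of "int N - 1 - int i"] assms
    by (simp add: of_nat_diff algebra_simps)
  from this[of \<xi>1] this[of \<xi>2] show ?thesis
    unfolding right_sol_def by simp algebra
qed

lemma left_sol_row_0: "(1 - r0) * left_sol 0 = p0 * left_sol 1"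
  by (simp add: left_sol_def v_def algebra_simps)

lemma right_sol_row_N: "(1 - rN) * right_sol N = qN * right_sol (N - 1)"
  using N_ge_2 by (simp add: right_sol_def w_def of_nat_diff power_int_minus algebra_simps)

text \<open>Up to normalisation, the defect of either solution in the other one's boundary equation is \<open>D\<close>.\<close>

lemma right_sol_row_0: "(1 - r0) * right_sol 0 - p0 * right_sol 1 = - det_D"
proof -
  obtain M where N: "N = M + 2" using N_ge_2 by (metis add.commute le_Suc_ex)
  then have M: "N - 2 = M" by simp
  have "\<xi> powi (int N - 1 - int 0) = \<xi> ^ M * \<xi>" "\<xi> powi (int N - 1 - int 1) = \<xi> ^ M" for \<xi> :: real
    using power_int_of_nat[of \<xi> "M + 1"] power_int_of_nat[of \<xi> M] N by (simp_all add: add_ac)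
  then show ?thesis
    unfolding right_sol_def det_D_def v_def M by (simp add: algebra_simps)
qed

lemma left_sol_row_N:
  "(p / q) ^ (N - 2) * ((1 - rN) * left_sol N - qN * left_sol (N - 1)) = det_D"
proof -
  obtain M where N: "N = M + 2" using N_ge_2 by (metis add.commute le_Suc_ex)
  then have M: "N - 2 = M" by simp
  have e: "\<xi> powi (1 - int N) = inverse (\<xi> ^ M) * inverse \<xi>"
          "\<xi> powi (1 - int (N - 1)) = inverse (\<xi> ^ M)" for \<xi> :: real
  proof -
    have "1 - int N = - int (M + 1)" "1 - int (N - 1) = - int M"
      using N by simp_all
    then show "\<xi> powi (1 - int N) = inverse (\<xi> ^ M) * inverse \<xi>"
      "\<xi> powi (1 - int (N - 1)) = inverse (\<xi> ^ M)"
      by (simp_all only: power_int_minus power_int_of_nat) simp_all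
  qed
  have defect: "(1 - rN) * left_sol N - qN * left_sol (N - 1) =
        inverse (\<xi>1 ^ M) * v \<xi>2 * w \<xi>1 - inverse (\<xi>2 ^ M) * v \<xi>1 * w \<xi>2"
    unfolding left_sol_def e by (simp add: w_def algebra_simps)
  show ?thesis
    unfolding defect det_D_def M ratio_power by (simp add: field_simps)
qed

text \<open>
  Terms containing two powers of the same root cancel; the mixed terms share the factor
  \<open>(\<xi>1 * \<xi>2) powi (- n)\<close>, which is \<open>(q / p) ^ n\<close>.
\<close>

lemma casoratian:
  "left_sol (n + 1) * right_sol n - left_sol n * right_sol (n + 1) =
   (\<xi>1 - \<xi>2) * (q / p) ^ n * det_D"
proof -
  obtain M where N: "N = M + 2" using N_ge_2 by (metis add.commute le_Suc_ex)
  then have M: "N - 2 = M" by simp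
  have e: "\<xi> powi (1 - int n) = \<xi> * inverse (\<xi> ^ n)"
          "\<xi> powi (1 - int (n + 1)) = inverse (\<xi> ^ n)"
          "\<xi> powi (int N - 1 - int n) = \<xi> ^ M * \<xi> * inverse (\<xi> ^ n)"
          "\<xi> powi (int N - 1 - int (n + 1)) = \<xi> ^ M * inverse (\<xi> ^ n)"
    if "\<xi> \<noteq> 0" for \<xi> :: real
  proof -
    show "\<xi> powi (1 - int n) = \<xi> * inverse (\<xi> ^ n)"
      using that power_int_diff[of \<xi> 1 "int n"] by (simp add: divide_inverse)
    show "\<xi> powi (1 - int (n + 1)) = inverse (\<xi> ^ n)"
      using that by (simp add: power_int_minus)
    have "int N - 1 - int n = int (M + 1) - int n" "int N - 1 - int (n + 1) = int M - int n"
      using N by simp_all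
    then show "\<xi> powi (int N - 1 - int n) = \<xi> ^ M * \<xi> * inverse (\<xi> ^ n)"
      "\<xi> powi (int N - 1 - int (n + 1)) = \<xi> ^ M * inverse (\<xi> ^ n)"
      using that power_int_diff[of \<xi> "int (M + 1)" "int n"] power_int_diff[of \<xi> "int M" "int n"]
      by (simp_all only: power_int_of_nat) (simp_all add: divide_inverse)
  qed
  have "(q / p) ^ n = inverse ((p / q) ^ n)"
    by (simp add: power_inverse[symmetric])
  then have "(q / p) ^ n = inverse (\<xi>1 ^ n) * inverse (\<xi>2 ^ n)"
    by (simp add: ratio_power)
  then show ?thesis
    unfolding left_sol_def right_sol_def det_D_def M e[OF roots_pos(3)] e[OF roots_pos(4)]
    by (simp add: algebra_simps)
qed

text \<open>
  The normalising constant of the Green function contains \<open>(p / q) ^ (n - 1)\<close>, which is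
  \<open>\<xi>1 ^ (n - 1) * \<xi>2 ^ (n - 1)\<close>.  Multiplied into the factor taken at the target \<open>n\<close>, it leaves
  exponents of the form \<open>n - 1\<close> and \<open>N - 2\<close> only.
\<close>

lemma left_sol_eq:
  assumes "1 \<le> n"
  shows "(p / q) ^ (n - 1) * left_sol n = \<xi>1 ^ (n - 1) * v \<xi>1 - \<xi>2 ^ (n - 1) * v \<xi>2"
proof -
  have e: "\<xi> powi (1 - int n) = inverse (\<xi> ^ (n - 1))" for \<xi> :: real
  proof -
    have "1 - int n = - int (n - 1)"
      using assms by simp
    then show ?thesis
      by (simp only: power_int_minus power_int_of_nat)
  qed
  show ?thesis
    unfolding left_sol_def ratio_power by (simp add: e algebra_simps)
qed

lemma right_sol_eq:
  assumes "1 \<le> n" "n \<le> N - 1"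
  shows "(p / q) ^ (n - 1) * right_sol n =
         \<xi>1 ^ (n - 1) * \<xi>2 ^ (N - 2) * w \<xi>1 - \<xi>1 ^ (N - 2) * \<xi>2 ^ (n - 1) * w \<xi>2"
proof -
  have e: "\<xi> powi (int N - 1 - int n) * \<xi> ^ (n - 1) = \<xi> ^ (N - 2)" for \<xi> :: real
  proof -
    have "int N - 1 - int n = int (N - 1 - n)"
      using assms by simp
    moreover have "N - 1 - n + (n - 1) = N - 2"
      using assms by simp
    ultimately show ?thesis
      by (metis power_add power_int_of_nat)
  qed
  show ?thesis
    unfolding right_sol_def ratio_power e[of \<xi>1, symmetric] e[of \<xi>2, symmetric] by (simp add: algebra_simps)
qed

section \<open>Expected numbers of visits\<close>

lemma visits_0_sums:
  assumes "i \<le> N"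
  shows "(\<lambda>k. kstep_prob step k i 0) sums (- right_sol i / det_D)"
proof -
  define c where "c = - 1 / det_D"
  have c: "c * ((1 - r0) * right_sol 0 - p0 * right_sol 1) = 1"
    using right_sol_row_0 det_D_neg by (simp add: c_def)
  have "(\<lambda>k. kstep_prob step k i 0) sums (c * right_sol i)"
  proof (rule visits_sums)
    have "(1 - r0) * (c * right_sol 0) = 1 + p0 * (c * right_sol 1)"
      using c by algebra
    then show "(1 - r0) * (c * right_sol 0) = of_bool (0 = (0::nat)) + p0 * (c * right_sol 1)"
      by simp
    show "(1 - rN) * (c * right_sol N) = of_bool (0 = N) + qN * (c * right_sol (N - 1))"
      using right_sol_row_N N_ge_2 by simp
    show "(1 - r) * (c * right_sol i) = of_bool (i = 0) + p * (c * right_sol (i + 1))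
            + q * (c * right_sol (i - 1))" if "0 < i" "i < N" for i
      using right_sol_interior[of i] that by simp algebra
  qed (use assms in auto)
  then show ?thesis by (simp add: c_def)
qed

lemma visits_N_sums:
  assumes "i \<le> N"
  shows "(\<lambda>k. kstep_prob step k i N) sums ((p / q) ^ (N - 2) * left_sol i / det_D)"
proof -
  define c where "c = (p / q) ^ (N - 2) / det_D"
  have c: "c * ((1 - rN) * left_sol N - qN * left_sol (N - 1)) = 1"
    using left_sol_row_N det_D_neg by (simp add: c_def)
  have "(\<lambda>k. kstep_prob step k i N) sums (c * left_sol i)"
  proof (rule visits_sums)
    show "(1 - r0) * (c * left_sol 0) = of_bool (N = 0) + p0 * (c * left_sol 1)"
      using left_sol_row_0 N_ge_2 by simp
    have "(1 - rN) * (c * left_sol N) = 1 + qN * (c * left_sol (N - 1))"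
      using c by algebra
    then show "(1 - rN) * (c * left_sol N) = of_bool (N = N) + qN * (c * left_sol (N - 1))"
      by simp
    show "(1 - r) * (c * left_sol i) = of_bool (i = N) + p * (c * left_sol (i + 1))
            + q * (c * left_sol (i - 1))" if "0 < i" "i < N" for i
      using left_sol_interior[of i] that by simp algebra
  qed (use assms in auto)
  then show ?thesis by (simp add: c_def)
qed

lemma visits_interior_sums:
  assumes "1 \<le> n" "n \<le> N - 1" "i \<le> N"
  shows "(\<lambda>k. kstep_prob step k i n) sums
           (inverse (q * (\<xi>1 - \<xi>2)) * (p / q) ^ (n - 1) / det_D *
            (left_sol (min i n) * right_sol (max i n)))"
proof -
  define c where "c = inverse (q * (\<xi>1 - \<xi>2)) * (p / q) ^ (n - 1) / det_D"
  define h where "h i = c * (left_sol (min i n) * right_sol (max i n))" for i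
  (* The jump at the source: c is normalised so that the Casoratian contributes exactly 1. *)
  have jump: "p * c * (left_sol (n + 1) * right_sol n - left_sol n * right_sol (n + 1)) = 1"
  proof -
    obtain m where "n = Suc m" using assms(1) by (cases n) auto
    moreover have "(p / q) ^ m * (q / p) ^ m = 1"
      using interior_weights by (simp add: power_mult_distrib[symmetric])
    ultimately show ?thesis
      unfolding casoratian c_def using interior_weights roots_order det_D_neg
      by (simp add: field_simps)
  qed
  have "(\<lambda>k. kstep_prob step k i n) sums h i"
  proof (rule visits_sums)
    show "(1 - r0) * h 0 = of_bool (n = 0) + p0 * h 1"
      using left_sol_row_0 assms by (simp add: h_def max_def min_def)
    have "h N = c * (left_sol n * right_sol N)"
      "h (N - 1) = c * (left_sol n * right_sol (N - 1))"
      using assms by (simp_all add: h_def min_absorb2 max_absorb1)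
    moreover have "n \<noteq> N"
      using assms N_ge_2 by simp
    ultimately show "(1 - rN) * h N = of_bool (n = N) + qN * h (N - 1)"
      using right_sol_row_N by simp
    show "(1 - r) * h i = of_bool (i = n) + p * h (i + 1) + q * h (i - 1)"
      if "0 < i" "i < N" for i
    proof -
      consider "i < n" | "i = n" | "n < i" by linarith
      then show ?thesis
      proof cases
        case 1
        then have "h i = c * (left_sol i * right_sol n)"
          "h (i + 1) = c * (left_sol (i + 1) * right_sol n)"
          "h (i - 1) = c * (left_sol (i - 1) * right_sol n)"
          by (simp_all add: h_def min_absorb1 max_absorb2)
        then show ?thesis
          using left_sol_interior[of i] that 1 by simp algebra
      next
        case 2
        then have "h i = c * (left_sol n * right_sol n)"
          "h (i + 1) = c * (left_sol n * right_sol (n + 1))"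
          "h (i - 1) = c * (left_sol (n - 1) * right_sol n)"
          by (simp_all add: h_def)
        moreover have "(1 - r) * left_sol n = p * left_sol (n + 1) + q * left_sol (n - 1)"
          using left_sol_interior[of n] that 2 by simp
        then have "(1 - r) * (c * (left_sol n * right_sol n)) =
            1 + p * (c * (left_sol n * right_sol (n + 1))) + q * (c * (left_sol (n - 1) * right_sol n))"
          using jump by algebra
        ultimately show ?thesis
          using 2 by simp
      next
        case 3
        then have "h i = c * (left_sol n * right_sol i)"
          "h (i + 1) = c * (left_sol n * right_sol (i + 1))"
          "h (i - 1) = c * (left_sol n * right_sol (i - 1))"
          by (simp_all add: h_def min_absorb2 max_absorb1)
        then show ?thesis
          using right_sol_interior[of i] that 3 by simp algebra
      qed
    qed
  qed (use assms in auto)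
  then show ?thesis by (simp add: h_def c_def)
qed

end

theorem theorem3:
  fixes p q r s p0 r0 s0 qN rN sN :: real
    and N i0 :: nat
    and x :: "nat \<Rightarrow> real"
    and xi1 xi2 zeta1 v1 v2 w1 w2 D :: real
  assumes "p > 0" "q > 0" "s > 0" "r \<ge> 0" "p + q + r + s = 1"
    and "p0 \<ge> 0" "r0 \<ge> 0" "s0 \<ge> 0" "p0 + r0 + s0 = 1"
    and "qN \<ge> 0" "rN \<ge> 0" "sN \<ge> 0" "qN + rN + sN = 1"
    and "r0 < 1" "rN < 1"
    and "N \<ge> 2" "i0 \<le> N"
    and x_def: "\<And>n. x n = (\<Sum>k. kstep_prob (pqrs_step N p q r s p0 r0 s0 qN rN sN) k i0 n)"
    and "xi1 = ((1 - r) + sqrt ((1 - r)^2 - 4 * p * q)) / (2 * q)"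
    and "xi2 = ((1 - r) - sqrt ((1 - r)^2 - 4 * p * q)) / (2 * q)"
    and "zeta1 = ((1 - r)^2 - 4 * p * q) powr (- 1 / 2)"
    and "v1 = p0 - (1 - r0) * xi1"
    and "v2 = p0 - (1 - r0) * xi2"
    and "w1 = qN - (1 - rN) * inverse xi1"
    and "w2 = qN - (1 - rN) * inverse xi2"
    and "D = xi2 ^ (N - 2) * v2 * w1 - xi1 ^ (N - 2) * v1 * w2"
  shows "(\<forall>n\<le>N. summable (\<lambda>k. kstep_prob (pqrs_step N p q r s p0 r0 s0 qN rN sN) k i0 n))
    \<and> D \<noteq> 0
    \<and> x 0 = (xi1 powi (int N - 1 - int i0) * w2 - xi2 powi (int N - 1 - int i0) * w1) / D
    \<and> (\<forall>n. 1 \<le> n \<and> n \<le> min i0 (N - 1) \<longrightarrow>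
         x n = zeta1 * (xi2 powi (int N - 1 - int i0) * w1 - xi1 powi (int N - 1 - int i0) * w2)
                 * (xi1 ^ (n - 1) * v1 - xi2 ^ (n - 1) * v2) / D)
    \<and> (\<forall>n. max i0 1 \<le> n \<and> n \<le> N - 1 \<longrightarrow>
         x n = zeta1 * (xi1 ^ (n - 1) * xi2 ^ (N - 2) * w1 - xi1 ^ (N - 2) * xi2 ^ (n - 1) * w2)
                 * (xi2 powi (1 - int i0) * v1 - xi1 powi (1 - int i0) * v2) / D)
    \<and> x N = (p / q) ^ (N - 2) * (xi2 powi (1 - int i0) * v1 - xi1 powi (1 - int i0) * v2) / D"
proof -
  define d where "d = sqrt ((1 - r)\<^sup>2 - 4 * p * q)"
  (* The discriminant is positive since 1 - r = p + q + s exceeds p + q. *)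
  have "(p + q)\<^sup>2 < (1 - r)\<^sup>2"
    using assms(1-5) by (intro power_strict_mono) auto
  moreover have "4 * p * q \<le> (p + q)\<^sup>2"
    using zero_le_power2[of "p - q"] by (simp add: power2_eq_square algebra_simps)
  ultimately have disc: "0 < (1 - r)\<^sup>2 - 4 * p * q"
    by linarith
  then have d: "0 < d" "d\<^sup>2 = (1 - r)\<^sup>2 - 4 * p * q"
    by (simp_all add: d_def)
  have "d < 1 - r"
    using d assms(1-5) by (intro power2_less_imp_less[of d "1 - r"]) auto
  have xi: "xi1 = ((1 - r) + d) / (2 * q)" "xi2 = ((1 - r) - d) / (2 * q)"
    unfolding d_def by (rule assms)+
  interpret pqrs_roots p q r s p0 r0 s0 qN rN sN N xi1 xi2
  proof
    show "q * (xi1 * xi2) = p"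
    proof -
      have "q * (xi1 * xi2) = ((1 - r)\<^sup>2 - d\<^sup>2) / (4 * q)"
        using \<open>q > 0\<close> unfolding xi by (simp add: field_simps power2_eq_square)
      then show ?thesis
        using d(2) \<open>q > 0\<close> by simp
    qed
    show "q * (xi1 + xi2) = 1 - r"
      using \<open>q > 0\<close> unfolding xi by (simp add: field_simps)
    show "0 < xi2"
      using \<open>q > 0\<close> \<open>d < 1 - r\<close> unfolding xi by simp
    show "xi2 < xi1"
      using \<open>q > 0\<close> d(1) unfolding xi by (simp add: divide_strict_right_mono)
  qed (rule assms)+
  have zeta: "zeta1 = inverse (q * (xi1 - xi2))"
  proof -
    have "zeta1 = inverse d"
      using assms(21) disc powr_minus[of "(1 - r)\<^sup>2 - 4 * p * q" "1 / 2"]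
      by (simp add: d_def powr_half_sqrt)
    also have "d = q * (xi1 - xi2)"
      using \<open>q > 0\<close> unfolding xi by (simp add: field_simps)
    finally show ?thesis .
  qed
  have names: "v1 = v xi1" "v2 = v xi2" "w1 = w xi1" "w2 = w xi2" "D = det_D"
    using assms(22-26) by (simp_all add: v_def w_def det_D_def)
  have x_eq: "x n = y" if "(\<lambda>k. kstep_prob step k i0 n) sums y" for n y
    unfolding x_def using sums_unique[OF that] by simp
  have summable: "summable (\<lambda>k. kstep_prob step k i0 n)" if n: "n \<le> N" for n
  proof -
    consider "n = 0" | "n = N" | "0 < n" "n < N"
      using n by linarith
    then show ?thesis
    proof cases
      case 1
      then show ?thesis
        using sums_summable[OF visits_0_sums[OF \<open>i0 \<le> N\<close>]] by simp
    next
      case 2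
      then show ?thesis
        using sums_summable[OF visits_N_sums[OF \<open>i0 \<le> N\<close>]] by simp
    next
      case 3
      then show ?thesis
        using sums_summable[OF visits_interior_sums[of n i0]] \<open>i0 \<le> N\<close> by simp
    qed
  qed
  have x_0: "x 0 = (xi1 powi (int N - 1 - int i0) * w2 - xi2 powi (int N - 1 - int i0) * w1) / D"
    using x_eq[OF visits_0_sums[OF \<open>i0 \<le> N\<close>]] by (simp add: right_sol_def names)
  have x_N: "x N = (p / q) ^ (N - 2) * (xi2 powi (1 - int i0) * v1 - xi1 powi (1 - int i0) * v2) / D"
    using x_eq[OF visits_N_sums[OF \<open>i0 \<le> N\<close>]] by (simp add: left_sol_def names)
  have x_below: "x n = zeta1 * (xi2 powi (int N - 1 - int i0) * w1 - xi1 powi (int N - 1 - int i0) * w2)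
                 * (xi1 ^ (n - 1) * v1 - xi2 ^ (n - 1) * v2) / D"
    if "1 \<le> n" "n \<le> min i0 (N - 1)" for n
  proof -
    have "n \<le> N - 1" "min i0 n = n" "max i0 n = i0"
      using that by simp_all
    then have "x n = zeta1 * (p / q) ^ (n - 1) / D * (left_sol n * right_sol i0)"
      using x_eq[OF visits_interior_sums[of n i0]] that(1) \<open>i0 \<le> N\<close> by (simp add: zeta names)
    also have "\<dots> = zeta1 * right_sol i0 * ((p / q) ^ (n - 1) * left_sol n) / D"
      by simp
    finally show ?thesis
      unfolding left_sol_eq[OF that(1)] by (simp only: right_sol_def names)
  qed
  have x_above: "x n = zeta1 * (xi1 ^ (n - 1) * xi2 ^ (N - 2) * w1 - xi1 ^ (N - 2) * xi2 ^ (n - 1) * w2)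
                 * (xi2 powi (1 - int i0) * v1 - xi1 powi (1 - int i0) * v2) / D"
    if "max i0 1 \<le> n" "n \<le> N - 1" for n
  proof -
    have n: "1 \<le> n" using that by simp
    have "x n = zeta1 * (p / q) ^ (n - 1) / D * (left_sol i0 * right_sol n)"
      using x_eq[OF visits_interior_sums[of n i0]] that \<open>i0 \<le> N\<close> by (simp add: zeta names)
    also have "\<dots> = zeta1 * ((p / q) ^ (n - 1) * right_sol n) * left_sol i0 / D"
      by simp
    finally show ?thesis
      unfolding right_sol_eq[OF n that(2)] by (simp only: left_sol_def names)
  qed
  show ?thesis
    using summable det_D_neg x_0 x_N x_below x_above by (auto simp: names(5))
qed

end
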